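(* Let $f=h+\overline{g}$ be a harmonic function in $\mathbb{D}$, where $h,g$ are analytic in $\mathbb{D}$ and $g(0)=0$, such that $\operatorname{Re} f\ge C$ in $\mathbb{D}$ for some real constant $C$, and $\operatorname{Im} h$ is non-vanishing in $\mathbb{D}$. If $f\in h^1$, then $\operatorname{Re} f\in \mathbf{h}\log^+\mathbf{h}$.
   Context: $\mathbb{D}=\{z\in\mathbb{C}:|z|<1\}$. A complex-valued function is harmonic in $\mathbb{D}$ if its real and imaginary parts are real-valued harmonic functions; every such function can be written $f=h+\overline g$ with $h,g$ analytic in $\mathbb{D}$, uniquely under the normalization $g(0)=0$. $h^1$ is the class of functions $f$ harmonic in $\mathbb{D}$ with $\lim_{r\to1^-}\frac1{2\pi}\int_0^{2\pi}|f(re^{i\theta})|\,d\theta<\infty$. $\log^+x=\max\{\log x,0\}$. The class $\mathbf{h}\log^+\mathbf{h}$ consists of the real-valued harmonic functions $u$ in $\mathbb{D}$ for which the integrals $\int_0^{2\pi}|u(re^{i\theta})|\log^+|u(re^{i\theta})|\,d\theta$ are bounded for $0<r<1$. *)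

theory Defs
  imports "HOL-Complex_Analysis.Complex_Analysis"
begin

(* Twice continuously differentiable with vanishing Laplacian: ux, uy are the first-order and
   uxx, uxy, uyx, uyy the second-order partial derivatives in the real coordinates
   (Re z, Im z); they are determined by u on the open set S. *)
definition real_harmonic_on :: "(complex \<Rightarrow> real) \<Rightarrow> complex set \<Rightarrow> bool" where
  "real_harmonic_on u S \<longleftrightarrow> open S \<and>
     (\<exists>ux uy uxx uxy uyx uyy :: complex \<Rightarrow> real.
        (\<forall>z\<in>S. (u has_derivative (\<lambda>w. ux z * Re w + uy z * Im w)) (at z)) \<and>
        (\<forall>z\<in>S. (ux has_derivative (\<lambda>w. uxx z * Re w + uxy z * Im w)) (at z)) \<and>
        (\<forall>z\<in>S. (uy has_derivative (\<lambda>w. uyx z * Re w + uyy z * Im w)) (at z)) \<and>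
        continuous_on S uxx \<and> continuous_on S uxy \<and>
        continuous_on S uyx \<and> continuous_on S uyy \<and>
        (\<forall>z\<in>S. uxx z + uyy z = 0))"

definition harmonic_on :: "(complex \<Rightarrow> complex) \<Rightarrow> complex set \<Rightarrow> bool" where
  "harmonic_on f S \<longleftrightarrow>
     real_harmonic_on (\<lambda>z. Re (f z)) S \<and> real_harmonic_on (\<lambda>z. Im (f z)) S"

abbreviation unit_disc :: "complex set" where
  "unit_disc \<equiv> ball 0 1"

definition h1_class :: "(complex \<Rightarrow> complex) set" where
  "h1_class = {f. harmonic_on f unit_disc \<and>
     (\<exists>L::real. ((\<lambda>r::real. 1 / (2 * pi) *
         integral {0..2 * pi} (\<lambda>\<theta>. cmod (f (of_real r * exp (\<i> * of_real \<theta>)))))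
       \<longlongrightarrow> L) (at_left 1))}"

(* Only used for nonnegative arguments; the value at 0 is 0, since ln 0 = 0 here. *)
definition log_plus :: "real \<Rightarrow> real" where
  "log_plus x = max (ln x) 0"

definition h_log_plus_h_class :: "(complex \<Rightarrow> real) set" where
  "h_log_plus_h_class = {u. real_harmonic_on u unit_disc \<and>
     bounded ((\<lambda>r::real. integral {0..2 * pi}
         (\<lambda>\<theta>. \<bar>u (of_real r * exp (\<i> * of_real \<theta>))\<bar> *
              log_plus \<bar>u (of_real r * exp (\<i> * of_real \<theta>))\<bar>)) ` {0<..<1})}"

end

theory Submission
  imports Defs
begin

text \<open>
  Put \<open>F = h + g\<close>, so that \<open>Re F = Re f\<close> and \<open>Im F = 2 Im h - Im f\<close>. Since \<open>Im h\<close> has constant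
  sign, the mean of \<open>\<bar>Im h\<bar>\<close> over each circle is \<open>\<bar>Im (h 0)\<bar>\<close>, so \<open>f \<in> h\<^sup>1\<close> bounds the means of
  \<open>\<bar>Im F\<bar>\<close>. After adding a constant we may assume \<open>Re F \<ge> 1\<close>. The mean value property of the
  analytic function \<open>F log F\<close>, whose real part is \<open>Re F log \<bar>F\<bar> - Im F arg F\<close> with
  \<open>\<bar>arg F\<bar> \<le> \<pi>/2\<close>, then bounds the means of \<open>Re F log Re F\<close>.
\<close>

text \<open>Cauchy's formula at the centre: on the circle, \<open>dw / w\<close> becomes
  \<open>\<i> d\<theta>\<close>. The \<open>has_integral\<close> form also gives integrability and
  passes to real and imaginary parts by linearity.\<close>

lemma has_integral_circle_mean:
  fixes G :: "complex \<Rightarrow> complex"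
  assumes "G holomorphic_on ball 0 R" "0 < r" "r < R"
  shows "((\<lambda>\<theta>. G (of_real r * exp (\<i> * of_real \<theta>))) has_integral of_real (2 * pi) * G 0) {0..2 * pi}"
proof -
  have hol: "G holomorphic_on cball 0 r"
    using assms by (auto intro: holomorphic_on_subset)
  have "((\<lambda>w. G w / (w - 0)) has_contour_integral (2 * of_real pi * \<i> * G 0)) (circlepath 0 r)"
    using hol assms by (intro Cauchy_integral_circlepath_simple) auto
  then have "((\<lambda>t. G (0 + of_real r * cis t) / (0 + of_real r * cis t - 0) * r * \<i> * cis t)
      has_integral (2 * of_real pi * \<i> * G 0)) {0..2 * pi}"
    unfolding circlepath_def
    by (subst (asm) has_contour_integral_part_circlepath_iff) auto
  then have "((\<lambda>t. \<i> * G (of_real r * exp (\<i> * of_real t)))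
      has_integral (2 * of_real pi * \<i> * G 0)) {0..2 * pi}"
    using assms by (simp add: cis_conv_exp mult_ac)
  from has_integral_mult_right[OF this, of "-\<i>"] show ?thesis
    by (simp add: mult_ac)
qed

lemma continuous_on_circle_compose:
  fixes F :: "complex \<Rightarrow> 'a::topological_space"
  assumes "continuous_on (ball 0 R) F" "0 < r" "r < R"
  shows "continuous_on A (\<lambda>\<theta>. F (of_real r * exp (\<i> * of_real \<theta>)))"
  using assms
  by (intro continuous_on_compose2[OF assms(1)] continuous_intros) (auto simp: norm_mult)

text \<open>By connectedness of the disc \<open>Im h\<close> keeps the sign it has at 0, so its
  absolute value is a constant multiple of \<open>Im h\<close>, and the mean value property
  applies.\<close>

lemma integral_abs_Im_circle_mean:
  fixes h :: "complex \<Rightarrow> complex"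
  assumes "h holomorphic_on ball 0 R" and nz: "\<And>z. z \<in> ball 0 R \<Longrightarrow> Im (h z) \<noteq> 0"
    and "0 < r" "r < R"
  shows "integral {0..2 * pi} (\<lambda>\<theta>. \<bar>Im (h (of_real r * exp (\<i> * of_real \<theta>)))\<bar>)
      = 2 * pi * \<bar>Im (h 0)\<bar>"
proof -
  let ?e = "\<lambda>\<theta>. of_real r * exp (\<i> * of_real \<theta>) :: complex"
  have conn: "connected ((\<lambda>z. Im (h z)) ` ball 0 R)"
    by (intro connected_continuous_image continuous_intros holomorphic_on_imp_continuous_on assms)
       auto
  have same: "sgn (Im (h z)) = sgn (Im (h 0))" if "z \<in> ball 0 R" for z
  proof (rule ccontr)
    assume "sgn (Im (h z)) \<noteq> sgn (Im (h 0))"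
    \<comment> \<open>Weak inequalities also cover a sign equal to 0; they are enough to place 0 in
      the image, which is an interval.\<close>
    then have "Im (h z) \<le> 0 \<and> 0 \<le> Im (h 0) \<or> Im (h 0) \<le> 0 \<and> 0 \<le> Im (h z)"
      by (auto simp: sgn_if split: if_splits)
    moreover have "0 \<in> ball (0::complex) R" using assms by auto
    ultimately have "0 \<in> (\<lambda>z. Im (h z)) ` ball 0 R"
      using connectedD_interval[OF conn] that by blast
    then show False using nz by force
  qed
  have "((\<lambda>\<theta>. Im (h (?e \<theta>))) has_integral 2 * pi * Im (h 0)) {0..2 * pi}"
    using has_integral_linear[OF has_integral_circle_mean[OF assms(1,3,4)] bounded_linear_Im]
    by (simp add: o_def)
  from has_integral_mult_right[OF this, of "sgn (Im (h 0))"]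
  have "((\<lambda>\<theta>. sgn (Im (h 0)) * Im (h (?e \<theta>))) has_integral 2 * pi * \<bar>Im (h 0)\<bar>) {0..2 * pi}"
    by (simp add: abs_sgn mult_ac)
  moreover have "sgn (Im (h 0)) * Im (h (?e \<theta>)) = \<bar>Im (h (?e \<theta>))\<bar>" for \<theta>
    using same[of "?e \<theta>"] assms by (simp add: abs_sgn norm_mult mult.commute)
  ultimately show ?thesis
    by (simp add: integral_unique)
qed

text \<open>The limit controls only radii close to 1. The remaining ones stay in a compact disc, on
  which \<open>F\<close> is bounded by continuity.\<close>

lemma bounded_circle_means:
  fixes F :: "complex \<Rightarrow> 'a::real_normed_vector"
  assumes cont: "continuous_on (ball 0 1) F"
    and lim: "((\<lambda>r::real. 1 / (2 * pi) *
         integral {0..2 * pi} (\<lambda>\<theta>. norm (F (of_real r * exp (\<i> * of_real \<theta>)))))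
       \<longlongrightarrow> L) (at_left 1)"
  obtains M where "\<And>r. 0 < r \<Longrightarrow> r < 1 \<Longrightarrow>
    integral {0..2 * pi} (\<lambda>\<theta>. norm (F (of_real r * exp (\<i> * of_real \<theta>)))) \<le> M"
proof -
  let ?I = "\<lambda>r. integral {0..2 * pi} (\<lambda>\<theta>. norm (F (of_real r * exp (\<i> * of_real \<theta>))))"
  have "eventually (\<lambda>r. 1 / (2 * pi) * ?I r < L + 1) (at_left 1)"
    using order_tendstoD(2)[OF lim, of "L + 1"] by simp
  then obtain b where b: "b < 1" "\<And>r. b < r \<Longrightarrow> r < 1 \<Longrightarrow> 1 / (2 * pi) * ?I r < L + 1"
    by (subst (asm) eventually_at_left[of 0]) auto
  have near: "?I r \<le> 2 * pi * (L + 1)" if "b < r" "r < 1" for r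
    using b(2)[OF that] by (simp add: field_simps)
  \<comment> \<open>If \<open>b\<close> is negative, this disc is empty and the case of radii up to
    \<open>b\<close> is vacuous.\<close>
  have "compact (F ` cball 0 b)"
    using b(1) by (intro compact_continuous_image continuous_on_subset[OF cont]) auto
  then obtain B where B: "\<And>z. norm z \<le> b \<Longrightarrow> norm (F z) \<le> B"
    by (meson bounded_iff compact_imp_bounded image_eqI mem_cball_0)
  have far: "?I r \<le> 2 * pi * B" if "0 < r" "r < 1" "r \<le> b" for r
  proof -
    have "?I r \<le> integral {0..2 * pi} (\<lambda>_. B)"
      using that
      by (intro integral_le integrable_continuous_real continuous_intros B
          continuous_on_circle_compose[OF cont]) (auto simp: norm_mult)
    then show ?thesis by simp
  qed
  show ?thesis
    by (rule that[of "max (2 * pi * (L + 1)) (2 * pi * B)"]) (use near far in force)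
qed

text \<open>A pointwise comparison with \<open>Re (F * Ln F)\<close>, integrated over the circle;
  the mean value property makes the main term independent of \<open>r\<close>.\<close>

lemma integral_Re_ln_Re_circle_le:
  fixes F :: "complex \<Rightarrow> complex"
  assumes hol: "F holomorphic_on ball 0 R" and ge: "\<And>z. z \<in> ball 0 R \<Longrightarrow> Re (F z) \<ge> 1"
    and r: "0 < r" "r < R"
  shows "integral {0..2 * pi} (\<lambda>\<theta>. Re (F (of_real r * exp (\<i> * of_real \<theta>))) *
            ln (Re (F (of_real r * exp (\<i> * of_real \<theta>)))))
      \<le> 2 * pi * Re (F 0 * Ln (F 0)) +
        pi / 2 * integral {0..2 * pi} (\<lambda>\<theta>. \<bar>Im (F (of_real r * exp (\<i> * of_real \<theta>)))\<bar>)"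
proof -
  let ?e = "\<lambda>\<theta>. of_real r * exp (\<i> * of_real \<theta>) :: complex"
  let ?G = "\<lambda>z. F z * Ln (F z)"
  have e: "?e \<theta> \<in> ball 0 R" for \<theta> using r by (simp add: norm_mult)
  \<comment> \<open>The lower bound on \<open>Re F\<close> keeps the values of \<open>F\<close> off
    the branch cut of \<open>Ln\<close>.\<close>
  have "?G holomorphic_on ball 0 R"
    using ge by (intro holomorphic_intros hol) (force simp: complex_nonpos_Reals_iff)
  from has_integral_linear[OF has_integral_circle_mean[OF this r] bounded_linear_Re]
  have G: "((\<lambda>\<theta>. Re (?G (?e \<theta>))) has_integral 2 * pi * Re (F 0 * Ln (F 0))) {0..2 * pi}"
    by (simp add: o_def)
  have cont: "continuous_on {0..2 * pi} (\<lambda>\<theta>. F (?e \<theta>))"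
    using r by (intro continuous_on_circle_compose[OF holomorphic_on_imp_continuous_on[OF hol]])
  have nz: "Re (F (?e \<theta>)) \<noteq> 0" for \<theta> using ge[OF e, of \<theta>] by linarith
  \<comment> \<open>Expand \<open>Re (w * Ln w)\<close> as
    \<open>Re w * ln (cmod w) - Im w * Im (Ln w)\<close>; in the right half-plane the argument
    \<open>Im (Ln w)\<close> is below \<open>pi / 2\<close> in modulus.\<close>
  have pt: "Re w * ln (Re w) \<le> Re (w * Ln w) + pi / 2 * \<bar>Im w\<bar>" if "Re w \<ge> 1" for w
  proof -
    from that have "Re w > 0" "w \<noteq> 0" by auto
    then have "\<bar>Im (Ln w)\<bar> < pi / 2"
      using Re_Ln_pos_lt by blast
    then have "\<bar>Im w * Im (Ln w)\<bar> \<le> \<bar>Im w\<bar> * (pi / 2)"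
      unfolding abs_mult by (intro mult_left_mono) auto
    then have "Im w * Im (Ln w) \<le> \<bar>Im w\<bar> * (pi / 2)"
      by linarith
    moreover have "Re w * ln (Re w) \<le> Re w * ln (cmod w)"
      using \<open>Re w > 0\<close> \<open>w \<noteq> 0\<close> by (intro mult_left_mono) (auto simp: complex_Re_le_cmod)
    ultimately show ?thesis
      using \<open>w \<noteq> 0\<close> by (simp add: mult.commute)
  qed
  have int: "(\<lambda>\<theta>. pi / 2 * \<bar>Im (F (?e \<theta>))\<bar>) integrable_on {0..2 * pi}"
    by (intro integrable_continuous_real continuous_intros cont)
  have "integral {0..2 * pi} (\<lambda>\<theta>. Re (F (?e \<theta>)) * ln (Re (F (?e \<theta>))))
      \<le> integral {0..2 * pi} (\<lambda>\<theta>. Re (?G (?e \<theta>)) + pi / 2 * \<bar>Im (F (?e \<theta>))\<bar>)"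
  proof (intro integral_le integrable_add has_integral_integrable[OF G] int pt ge e)
    show "(\<lambda>\<theta>. Re (F (?e \<theta>)) * ln (Re (F (?e \<theta>)))) integrable_on {0..2 * pi}"
      using nz by (intro integrable_continuous_real continuous_intros cont) blast
  qed
  also have "\<dots> = 2 * pi * Re (F 0 * Ln (F 0)) +
      pi / 2 * integral {0..2 * pi} (\<lambda>\<theta>. \<bar>Im (F (?e \<theta>))\<bar>)"
    by (subst integral_add[OF has_integral_integrable[OF G] int])
       (simp only: integral_unique[OF G] integral_mult_right)
  finally show ?thesis .
qed

lemma mult_log_plus_mono:
  assumes "0 \<le> x" "x \<le> y"
  shows "x * log_plus x \<le> y * log_plus y"
\<comment> \<open>Since \<open>ln 0 = 0\<close>, monotonicity of \<open>ln\<close> fails at 0, which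
  is therefore treated apart.\<close>
proof (cases "x = 0")
  case False
  with assms have "ln x \<le> ln y" by simp
  with assms show ?thesis
    by (intro mult_mono) (auto simp: log_plus_def)
qed (use assms in \<open>simp add: log_plus_def\<close>)

text \<open>Serves integrability on circles where \<open>Re f\<close> may vanish. Writing
  \<open>ln (max x 1)\<close> for \<open>log_plus x\<close> keeps the argument of \<open>ln\<close>
  away from 0.\<close>

lemma continuous_on_mult_log_plus:
  "continuous_on {0..} (\<lambda>x. x * log_plus x)"
proof -
  have "x * ln (max x 1) = x * log_plus x" if "x \<in> {0..}" for x
  proof (cases "x < 1")
    case True
    with that have "ln x \<le> 0" by (cases "x = 0") auto
    with True show ?thesis by (auto simp: log_plus_def)
  qed (simp add: log_plus_def)
  moreover have "continuous_on {0..} (\<lambda>x::real. x * ln (max x 1))"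
    by (intro continuous_intros) auto
  ultimately show ?thesis
    by (rule continuous_on_eq[rotated])
qed

theorem theorem2:
  fixes f h g :: "complex \<Rightarrow> complex" and C :: real
  assumes "harmonic_on f unit_disc"
    and "h analytic_on unit_disc"
    and "g analytic_on unit_disc"
    and "\<And>z. z \<in> unit_disc \<Longrightarrow> f z = h z + cnj (g z)"
    and "g 0 = 0"
    and "\<And>z. z \<in> unit_disc \<Longrightarrow> Re (f z) \<ge> C"
    and "\<And>z. z \<in> unit_disc \<Longrightarrow> Im (h z) \<noteq> 0"
    and "f \<in> h1_class"
  shows "(\<lambda>z. Re (f z)) \<in> h_log_plus_h_class"
proof -
  let ?e = "\<lambda>r \<theta>. of_real r * exp (\<i> * of_real \<theta>) :: complex"
  \<comment> \<open>This shift gives \<open>Re f + K \<ge> 1\<close>. Being nonnegative, it also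
    gives \<open>Re f \<le> Re F\<close>; being real, it leaves \<open>Im F\<close>
    unchanged.\<close>
  define K where "K = 1 + \<bar>C\<bar>"
  define F where "F = (\<lambda>z. h z + g z + of_real K)"
  define T where "T = (\<lambda>x::real. x * log_plus x)"
  have holh: "h holomorphic_on ball 0 1" and holg: "g holomorphic_on ball 0 1"
    using assms(2,3) by (auto simp: analytic_imp_holomorphic)
  have holF: "F holomorphic_on ball 0 1"
    unfolding F_def by (intro holomorphic_intros holh holg)
  have "continuous_on (ball 0 1) (\<lambda>z. h z + cnj (g z))"
    by (intro continuous_intros holomorphic_on_imp_continuous_on holh holg)
  then have contf: "continuous_on (ball 0 1) f"
    by (rule continuous_on_eq) (simp add: assms(4))
  have ReF: "Re (F z) = Re (f z) + K" and ImF: "Im (F z) = 2 * Im (h z) - Im (f z)"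
    if "z \<in> ball 0 1" for z
    using assms(4)[OF that] by (auto simp: F_def)
  have geF: "Re (F z) \<ge> 1" if "z \<in> ball 0 1" for z
    using ReF[OF that] assms(6)[OF that] by (auto simp: K_def)
  obtain M where M: "\<And>r. 0 < r \<Longrightarrow> r < 1 \<Longrightarrow> integral {0..2 * pi} (\<lambda>\<theta>. norm (f (?e r \<theta>))) \<le> M"
    using assms(8) bounded_circle_means[OF contf] unfolding h1_class_def by blast
  \<comment> \<open>The terms are the central value of \<open>F * Ln F\<close>, the bound for the
    integral of the modulus of \<open>Im F\<close>, and the contribution of points where
    \<open>Re f\<close> is negative.\<close>
  define B where "B = 2 * pi * Re (F 0 * Ln (F 0)) +
      pi / 2 * (4 * pi * \<bar>Im (h 0)\<bar> + M) + 2 * pi * T \<bar>C\<bar>"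
  have "\<bar>integral {0..2 * pi} (\<lambda>\<theta>. T \<bar>Re (f (?e r \<theta>))\<bar>)\<bar> \<le> B" if r: "0 < r" "r < 1" for r
  proof -
    have e: "?e r \<theta> \<in> ball 0 1" for \<theta> using r by (simp add: norm_mult)
    note cont = continuous_on_circle_compose[OF _ r]
    have cF: "continuous_on {0..2 * pi} (\<lambda>\<theta>. F (?e r \<theta>))"
      and ch: "continuous_on {0..2 * pi} (\<lambda>\<theta>. h (?e r \<theta>))"
      and cf: "continuous_on {0..2 * pi} (\<lambda>\<theta>. f (?e r \<theta>))"
      by (intro cont holomorphic_on_imp_continuous_on holF holh contf)+
    have T0: "T x \<ge> 0" if "x \<ge> 0" for x
      using that by (simp add: T_def log_plus_def)
    have TF: "T (Re (F z)) = Re (F z) * ln (Re (F z))" if "z \<in> ball 0 1" for z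
      using geF[OF that] by (simp add: T_def log_plus_def)
    \<comment> \<open>Both summands are nonnegative. The first dominates where
      \<open>Re f \<ge> 0\<close>; elsewhere \<open>C \<le> Re f < 0\<close>, and the second
      does.\<close>
    have pt: "T \<bar>Re (f z)\<bar> \<le> Re (F z) * ln (Re (F z)) + T \<bar>C\<bar>" if z: "z \<in> ball 0 1" for z
    proof (cases "Re (f z) \<ge> 0")
      case True
      then have "T \<bar>Re (f z)\<bar> \<le> T (Re (F z))"
        unfolding T_def using ReF[OF z] by (intro mult_log_plus_mono) (auto simp: K_def)
      then show ?thesis using T0[of "\<bar>C\<bar>"] TF[OF z] by simp
    next
      case False
      then have "T \<bar>Re (f z)\<bar> \<le> T \<bar>C\<bar>"
        unfolding T_def using assms(6)[OF z] by (intro mult_log_plus_mono) auto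
      moreover have "T (Re (F z)) \<ge> 0" using geF[OF z] by (intro T0) auto
      ultimately show ?thesis using TF[OF z] by simp
    qed
    have nz: "Re (F (?e r \<theta>)) \<noteq> 0" for \<theta> using geF[OF e, of \<theta>] by linarith
    have intF: "(\<lambda>\<theta>. Re (F (?e r \<theta>)) * ln (Re (F (?e r \<theta>)))) integrable_on {0..2 * pi}"
      using nz by (intro integrable_continuous_real continuous_intros cF) blast
    have intT: "(\<lambda>\<theta>. T \<bar>Re (f (?e r \<theta>))\<bar>) integrable_on {0..2 * pi}"
      unfolding T_def
      by (intro integrable_continuous_real continuous_on_compose2[OF continuous_on_mult_log_plus]
          continuous_intros cf) auto
    have "integral {0..2 * pi} (\<lambda>\<theta>. \<bar>Im (F (?e r \<theta>))\<bar>)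
        \<le> integral {0..2 * pi} (\<lambda>\<theta>. 2 * \<bar>Im (h (?e r \<theta>))\<bar> + norm (f (?e r \<theta>)))"
    proof (intro integral_le integrable_continuous_real continuous_intros cF ch cf)
      fix \<theta>
      show "\<bar>Im (F (?e r \<theta>))\<bar> \<le> 2 * \<bar>Im (h (?e r \<theta>))\<bar> + norm (f (?e r \<theta>))"
        using ImF[OF e, of \<theta>] abs_Im_le_cmod[of "f (?e r \<theta>)"] by linarith
    qed
    also have "\<dots> = 2 * integral {0..2 * pi} (\<lambda>\<theta>. \<bar>Im (h (?e r \<theta>))\<bar>)
        + integral {0..2 * pi} (\<lambda>\<theta>. norm (f (?e r \<theta>)))"
      by (subst integral_add)
         (auto intro!: integrable_continuous_real continuous_intros ch cf)
    \<comment> \<open>This is where the non-vanishing of \<open>Im h\<close> and the membership of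
      \<open>f\<close> in \<open>h1_class\<close> enter.\<close>
    also have "\<dots> \<le> 4 * pi * \<bar>Im (h 0)\<bar> + M"
      using integral_abs_Im_circle_mean[OF holh assms(7) r] M[OF r] by simp
    finally have ImF_le: "integral {0..2 * pi} (\<lambda>\<theta>. \<bar>Im (F (?e r \<theta>))\<bar>) \<le> \<dots>" .
    have "integral {0..2 * pi} (\<lambda>\<theta>. T \<bar>Re (f (?e r \<theta>))\<bar>)
        \<le> integral {0..2 * pi} (\<lambda>\<theta>. Re (F (?e r \<theta>)) * ln (Re (F (?e r \<theta>))) + T \<bar>C\<bar>)"
      by (intro integral_le intT integrable_add intF pt e) auto
    also have "\<dots> = integral {0..2 * pi} (\<lambda>\<theta>. Re (F (?e r \<theta>)) * ln (Re (F (?e r \<theta>))))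
        + 2 * pi * T \<bar>C\<bar>"
      by (subst integral_add[OF intF]) auto
    also have "\<dots> \<le> 2 * pi * Re (F 0 * Ln (F 0)) +
        pi / 2 * integral {0..2 * pi} (\<lambda>\<theta>. \<bar>Im (F (?e r \<theta>))\<bar>) + 2 * pi * T \<bar>C\<bar>"
      using integral_Re_ln_Re_circle_le[OF holF geF r] by simp
    also have "\<dots> \<le> B"
      unfolding B_def by (intro add_mono mult_left_mono ImF_le order_refl) auto
    finally have "integral {0..2 * pi} (\<lambda>\<theta>. T \<bar>Re (f (?e r \<theta>))\<bar>) \<le> B" .
    moreover have "integral {0..2 * pi} (\<lambda>\<theta>. T \<bar>Re (f (?e r \<theta>))\<bar>) \<ge> 0"
      by (intro integral_nonneg intT T0) auto
    ultimately show ?thesis by simp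
  qed
  then have "bounded ((\<lambda>r::real. integral {0..2 * pi} (\<lambda>\<theta>. T \<bar>Re (f (?e r \<theta>))\<bar>)) ` {0<..<1})"
    by (intro boundedI[of _ B]) auto
  then show ?thesis
    using assms(1) by (simp add: h_log_plus_h_class_def harmonic_on_def T_def)
qed

end
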